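(* Let $(\Gamma,L,M)$ be an uncertainty space, let $(p_k)_{k\ge1}$ be positive real numbers with $P_n=\sum_{k=1}^n p_k$, and let $(\xi_n)_{n\ge1}$ be a sequence of uncertain variables and $\xi$ an uncertain variable on $(\Gamma,L,M)$. Then $(\xi_n)\in u_R$ if and only if $(\xi_n)\in\tilde u_R$ (both with limit $\xi$).
   Context: An uncertainty space $(\Gamma,L,M)$ (in the sense of Liu) consists of a nonempty set $\Gamma$, a $\sigma$-algebra $L$ on $\Gamma$, and an uncertain measure $M:L\to[0,1]$, i.e. a set function with $M(\Gamma)=1$, $M(A)+M(\Gamma\setminus A)=1$ for all $A\in L$, and $M(\bigcup_i A_i)\le\sum_i M(A_i)$ for every countable family $(A_i)$ in $L$. An uncertain variable is a measurable function $\Gamma\to\mathbb{R}$. $u_R$ is the set of sequences $(\xi_n)$ that are Riesz type convergent uniformly almost surely to $\xi$: there exists a sequence of events $(E_k)$ in $L$ with $M(E_k)\to0$ as $k\to\infty$ such that, for each fixed $k$, the Riesz means $\sum_{i=1}^n\frac{p_i}{P_n}\xi_i$ converge to $\xi$ uniformly on $\Gamma\setminus E_k$ as $n\to\infty$. $\tilde u_R$ is the set of sequences $(\xi_n)$ such that for every $\epsilon>0$, $$\lim_{m\to\infty}M\Bigl(\bigcup_{n=m}^\infty\Bigl\{\gamma\in\Gamma:\Bigl|\sum_{i=1}^n\frac{p_i}{P_n}\xi_i(\gamma)-\xi(\gamma)\Bigr|\ge\epsilon\Bigr\}\Bigr)=0.$$ *)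

theory Defs
  imports "HOL-Analysis.Analysis"
begin

text \<open>
  Uncertainty spaces in the sense of Liu. The set function \<open>M\<close> is a total function on
  \<open>'a set\<close>; only its values on \<open>L\<close> matter. Subadditivity is stated in \<open>ennreal\<close>, so that
  a divergent right-hand side counts as infinity. Finite families are covered by padding
  with the empty set, for which \<open>total\<close> and \<open>dual\<close> give \<open>M {} = 0\<close>.
\<close>

locale uncertainty_space = sigma_algebra \<Gamma> L
  for \<Gamma> :: "'a set" and L :: "'a set set" +
  fixes M :: "'a set \<Rightarrow> real"
  assumes nonempty: "\<Gamma> \<noteq> {}"
    and range01: "A \<in> L \<Longrightarrow> M A \<in> {0..1}"
    and total: "M \<Gamma> = 1"
    and dual: "A \<in> L \<Longrightarrow> M A + M (\<Gamma> - A) = 1"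
    and subadd: "range (F :: nat \<Rightarrow> 'a set) \<subseteq> L \<Longrightarrow>
      ennreal (M (\<Union>i. F i)) \<le> (\<Sum>i. ennreal (M (F i)))"

text \<open>
  The library's \<open>sigma \<Gamma> L\<close> serves only to carry the measurable space;
  its (zero) measure plays no role.
\<close>

definition uncertain_variable :: "'a set \<Rightarrow> 'a set set \<Rightarrow> ('a \<Rightarrow> real) \<Rightarrow> bool" where
  "uncertain_variable \<Gamma> L \<xi> \<longleftrightarrow> \<xi> \<in> borel_measurable (sigma \<Gamma> L)"

text \<open>
  Sequences are indexed from 1: the values of \<open>p\<close> and \<open>\<xi>s\<close> at 0 are never used.
\<close>

definition partial_weight :: "(nat \<Rightarrow> real) \<Rightarrow> nat \<Rightarrow> real" where
  "partial_weight p n = (\<Sum>k=1..n. p k)"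

definition riesz_mean :: "(nat \<Rightarrow> real) \<Rightarrow> (nat \<Rightarrow> 'a \<Rightarrow> real) \<Rightarrow> nat \<Rightarrow> 'a \<Rightarrow> real" where
  "riesz_mean p \<xi>s n \<gamma> = (\<Sum>i=1..n. p i / partial_weight p n * \<xi>s i \<gamma>)"

definition u_R ::
  "'a set \<Rightarrow> 'a set set \<Rightarrow> ('a set \<Rightarrow> real) \<Rightarrow> (nat \<Rightarrow> real) \<Rightarrow> ('a \<Rightarrow> real) \<Rightarrow> (nat \<Rightarrow> 'a \<Rightarrow> real) set"
where
  "u_R \<Gamma> L M p \<xi> = {\<xi>s. (\<forall>n\<ge>1. uncertain_variable \<Gamma> L (\<xi>s n)) \<and>
     (\<exists>E :: nat \<Rightarrow> 'a set. (\<forall>k. E k \<in> L) \<and> (\<lambda>k. M (E k)) \<longlonglongrightarrow> 0 \<and>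
        (\<forall>k. uniform_limit (\<Gamma> - E k) (riesz_mean p \<xi>s) \<xi> sequentially))}"

definition u_R_tilde ::
  "'a set \<Rightarrow> 'a set set \<Rightarrow> ('a set \<Rightarrow> real) \<Rightarrow> (nat \<Rightarrow> real) \<Rightarrow> ('a \<Rightarrow> real) \<Rightarrow> (nat \<Rightarrow> 'a \<Rightarrow> real) set"
where
  "u_R_tilde \<Gamma> L M p \<xi> = {\<xi>s. (\<forall>n\<ge>1. uncertain_variable \<Gamma> L (\<xi>s n)) \<and>
     (\<forall>\<epsilon>>0. (\<lambda>m. M (\<Union>n\<in>{m..}. {\<gamma>\<in>\<Gamma>. \<bar>riesz_mean p \<xi>s n \<gamma> - \<xi> \<gamma>\<bar> \<ge> \<epsilon>})) \<longlonglongrightarrow> 0)}"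

end

theory Submission
  imports Defs
begin

text \<open>
  This is Egorov's theorem for an uncertain measure, applied to the Riesz means. These
  are measurable, so the two implications are proved for an arbitrary measurable sequence
  \<open>X\<close> with measurable candidate limit \<open>Y\<close>. The object linking the two modes of
  convergence is the event, below called \<open>tail_deviation\<close>, that \<open>X n\<close> is at distance at least
  \<open>\<epsilon>\<close> from \<open>Y\<close> for some \<open>n \<ge> m\<close>.

  If the convergence is uniform off \<open>E k\<close>, then the tail deviation event lies inside \<open>E k\<close> as soon
  as \<open>m\<close> is large, so its measure is at most \<open>M (E k)\<close>, which is as small as desired
  (\<open>tail_deviation_tendsto_zero\<close>). Monotonicity of \<open>M\<close> is not an axiom; duality together with
  subadditivity gives it (\<open>measure_mono\<close>).

  Conversely, for each tolerance \<open>1 / (j + 1)\<close> one picks an index at which the tail deviation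
  event has measure at most \<open>d / 2 ^ (j + 1)\<close>. Off the union of these events the convergence is
  uniform by construction, and countable subadditivity bounds the measure of the union by \<open>d\<close>
  (\<open>uniform_limit_off_small_event\<close>). Letting \<open>d\<close> run through a null sequence yields the
  exceptional events. In classical measure theory the smallness of the tail events comes from
  almost sure convergence through continuity from above. An uncertain measure need not be
  continuous, and that is why the smallness is itself the hypothesis in the definition of
  \<open>u_R_tilde\<close>.
\<close>

definition tail_deviation ::
  "'a set \<Rightarrow> (nat \<Rightarrow> 'a \<Rightarrow> real) \<Rightarrow> ('a \<Rightarrow> real) \<Rightarrow> real \<Rightarrow> nat \<Rightarrow> 'a set" where
  "tail_deviation \<Gamma> X Y \<epsilon> m = (\<Union>n\<in>{m..}. {\<gamma>\<in>\<Gamma>. \<bar>X n \<gamma> - Y \<gamma>\<bar> \<ge> \<epsilon>})"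

context uncertainty_space
begin

lemma measure_nonneg: "A \<in> L \<Longrightarrow> 0 \<le> M A"
  using range01 by auto

lemma measure_empty: "M {} = 0"
  using dual[of \<Gamma>] total by simp

lemma measure_Un_le:
  assumes "A \<in> L" "B \<in> L"
  shows "M (A \<union> B) \<le> M A + M B"
proof -
  have "ennreal (M (\<Union>i. binaryset A B i)) \<le> (\<Sum>i. ennreal (M (binaryset A B i)))"
    using assms by (intro subadd) (auto simp: binaryset_def)
  also have "\<dots> = ennreal (M A) + ennreal (M B)"
    using suminf_binaryset_eq[of "\<lambda>S. ennreal (M S)" A B] by (simp add: measure_empty)
  also have "\<dots> = ennreal (M A + M B)"
    using assms by (simp add: ennreal_plus measure_nonneg)
  finally have "ennreal (M (A \<union> B)) \<le> ennreal (M A + M B)"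
    by (simp add: UN_binaryset_eq)
  then show ?thesis
    using assms measure_nonneg by (subst (asm) ennreal_le_iff) auto
qed

text \<open>
  If \<open>A \<subseteq> B\<close> then \<open>B\<close> and the complement of \<open>A\<close> cover the space, so
  \<open>1 \<le> M B + M (\<Gamma> - A) = M B + 1 - M A\<close>.
\<close>

lemma measure_mono:
  assumes "A \<in> L" "B \<in> L" "A \<subseteq> B"
  shows "M A \<le> M B"
proof -
  have "B \<union> (\<Gamma> - A) = \<Gamma>"
    using assms sets_into_space by blast
  then have "1 \<le> M B + M (\<Gamma> - A)"
    using measure_Un_le[of B "\<Gamma> - A"] assms total by auto
  then show ?thesis
    using dual[OF assms(1)] by simp
qed

lemma measure_UN_le_suminf:
  assumes "\<And>i. F i \<in> L" "\<And>i. M (F i) \<le> f i" "f sums s"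
  shows "M (\<Union>i::nat. F i) \<le> s"
proof -
  have f: "0 \<le> f i" for i
    using measure_nonneg[OF assms(1)] assms(2) order_trans by blast
  have "ennreal (M (\<Union>i. F i)) \<le> (\<Sum>i. ennreal (M (F i)))"
    using assms(1) by (intro subadd) auto
  also have "\<dots> \<le> (\<Sum>i. ennreal (f i))"
    by (intro suminf_le) (auto intro: ennreal_leI assms(2))
  also have "\<dots> = ennreal s"
    by (rule suminf_ennreal_eq[OF f assms(3)])
  finally show ?thesis
    using sums_le[OF _ sums_zero assms(3)] f by (simp add: ennreal_le_iff)
qed

lemma tail_deviation_event:
  assumes "\<And>n. uncertain_variable \<Gamma> L (X n)" "uncertain_variable \<Gamma> L Y"
  shows "tail_deviation \<Gamma> X Y \<epsilon> m \<in> L"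
proof -
  have [measurable]: "X n \<in> borel_measurable (sigma \<Gamma> L)" "Y \<in> borel_measurable (sigma \<Gamma> L)" for n
    using assms unfolding uncertain_variable_def by auto
  have "{\<gamma>\<in>space (sigma \<Gamma> L). \<epsilon> \<le> \<bar>X n \<gamma> - Y \<gamma>\<bar>} \<in> sets (sigma \<Gamma> L)" for n
    by measurable
  then have "{\<gamma>\<in>\<Gamma>. \<epsilon> \<le> \<bar>X n \<gamma> - Y \<gamma>\<bar>} \<in> L" for n
    using space_closed by (simp add: sigma_sets_eq)
  then show ?thesis
    unfolding tail_deviation_def by (intro countable_UN') auto
qed

text \<open>
  Uniform convergence off \<open>E k\<close> means that every tail deviation event is eventually swallowed
  by \<open>E k\<close>.
\<close>

lemma tail_deviation_tendsto_zero:
  assumes X: "\<And>n. uncertain_variable \<Gamma> L (X n)" and Y: "uncertain_variable \<Gamma> L Y"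
    and E: "\<And>k. E k \<in> L" "(\<lambda>k. M (E k)) \<longlonglongrightarrow> 0"
    and unif: "\<And>k. uniform_limit (\<Gamma> - E k) X Y sequentially"
    and "\<epsilon> > 0"
  shows "(\<lambda>m. M (tail_deviation \<Gamma> X Y \<epsilon> m)) \<longlonglongrightarrow> 0"
proof -
  have event: "tail_deviation \<Gamma> X Y \<epsilon> m \<in> L" for m
    by (rule tail_deviation_event[OF X Y])
  show ?thesis
  proof (rule order_tendstoI)
    fix a :: real assume "a < 0"
    then show "\<forall>\<^sub>F m in sequentially. a < M (tail_deviation \<Gamma> X Y \<epsilon> m)"
      using measure_nonneg[OF event] by (simp add: less_le_trans)
  next
    fix a :: real assume "0 < a"
    then obtain k where k: "M (E k) < a"
      using order_tendstoD(2)[OF E(2)] eventually_sequentially by (metis order_refl)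
    obtain N where N: "\<And>n \<gamma>. n \<ge> N \<Longrightarrow> \<gamma> \<in> \<Gamma> - E k \<Longrightarrow> dist (X n \<gamma>) (Y \<gamma>) < \<epsilon>"
      using uniform_limitD[OF unif \<open>\<epsilon> > 0\<close>] unfolding eventually_sequentially by blast
    have "tail_deviation \<Gamma> X Y \<epsilon> m \<subseteq> E k" if "m \<ge> N" for m
    proof
      fix \<gamma> assume "\<gamma> \<in> tail_deviation \<Gamma> X Y \<epsilon> m"
      then obtain n where n: "n \<ge> m" "\<gamma> \<in> \<Gamma>" "\<epsilon> \<le> dist (X n \<gamma>) (Y \<gamma>)"
        by (auto simp: tail_deviation_def dist_real_def)
      then show "\<gamma> \<in> E k"
        using N[of n \<gamma>] that by (cases "\<gamma> \<in> E k") auto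
    qed
    then have "M (tail_deviation \<Gamma> X Y \<epsilon> m) < a" if "m \<ge> N" for m
      using measure_mono[OF event E(1)] that
      by (intro le_less_trans[OF _ k]) simp
    then show "\<forall>\<^sub>F m in sequentially. M (tail_deviation \<Gamma> X Y \<epsilon> m) < a"
      unfolding eventually_sequentially by blast
  qed
qed

text \<open>
  The construction in Egorov's theorem: the total allowance \<open>d\<close> is shared out
  geometrically among the tolerances \<open>1 / (j + 1)\<close>.
\<close>

lemma uniform_limit_off_small_event:
  assumes X: "\<And>n. uncertain_variable \<Gamma> L (X n)" and Y: "uncertain_variable \<Gamma> L Y"
    and lim: "\<And>\<epsilon>. \<epsilon> > 0 \<Longrightarrow> (\<lambda>m. M (tail_deviation \<Gamma> X Y \<epsilon> m)) \<longlonglongrightarrow> 0"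
    and "d > 0"
  obtains E where "E \<in> L" "M E \<le> d" "uniform_limit (\<Gamma> - E) X Y sequentially"
proof -
  define B where "B j = tail_deviation \<Gamma> X Y (1 / real (Suc j))" for j
  have "\<exists>m. M (B j m) \<le> d * (1/2) ^ Suc j" for j
  proof -
    have "\<forall>\<^sub>F m in sequentially. M (B j m) < d * (1/2) ^ Suc j"
      unfolding B_def using \<open>d > 0\<close> by (intro order_tendstoD(2)[OF lim]) auto
    then show ?thesis
      unfolding eventually_sequentially using less_imp_le by blast
  qed
  then obtain m where m: "\<And>j. M (B j (m j)) \<le> d * (1/2) ^ Suc j"
    by metis
  define E where "E = (\<Union>j. B j (m j))"
  have B: "B j k \<in> L" for j k
    unfolding B_def by (rule tail_deviation_event[OF X Y])
  have "M E \<le> d"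
    unfolding E_def using sums_mult[OF power_half_series, of d]
    by (intro measure_UN_le_suminf[where f = "\<lambda>j. d * (1/2) ^ Suc j"] B m) simp
  moreover have "E \<in> L"
    unfolding E_def using B by blast
  moreover have "uniform_limit (\<Gamma> - E) X Y sequentially"
  proof (rule uniform_limitI)
    fix e :: real assume "e > 0"
    then obtain j where j: "1 / real (Suc j) < e"
      using nat_approx_posE by blast
    have "dist (X n \<gamma>) (Y \<gamma>) < e" if "n \<ge> m j" "\<gamma> \<in> \<Gamma> - E" for n \<gamma>
    proof -
      have "\<gamma> \<notin> B j (m j)"
        using that by (auto simp: E_def)
      then have "\<bar>X n \<gamma> - Y \<gamma>\<bar> < 1 / real (Suc j)"
        using that by (auto simp: B_def tail_deviation_def not_le)
      then show ?thesis
        using j by (simp add: dist_real_def)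
    qed
    then show "\<forall>\<^sub>F n in sequentially. \<forall>\<gamma>\<in>\<Gamma> - E. dist (X n \<gamma>) (Y \<gamma>) < e"
      unfolding eventually_sequentially by blast
  qed
  ultimately show ?thesis
    using that by blast
qed

lemma egorov_iff:
  assumes X: "\<And>n. uncertain_variable \<Gamma> L (X n)" and Y: "uncertain_variable \<Gamma> L Y"
  shows "(\<exists>E :: nat \<Rightarrow> 'a set. (\<forall>k. E k \<in> L) \<and> (\<lambda>k. M (E k)) \<longlonglongrightarrow> 0 \<and>
           (\<forall>k. uniform_limit (\<Gamma> - E k) X Y sequentially))
     \<longleftrightarrow> (\<forall>\<epsilon>>0. (\<lambda>m. M (tail_deviation \<Gamma> X Y \<epsilon> m)) \<longlonglongrightarrow> 0)"
proof
  assume "\<forall>\<epsilon>>0. (\<lambda>m. M (tail_deviation \<Gamma> X Y \<epsilon> m)) \<longlonglongrightarrow> 0"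
  then have lim: "(\<lambda>m. M (tail_deviation \<Gamma> X Y \<epsilon> m)) \<longlonglongrightarrow> 0" if "\<epsilon> > 0" for \<epsilon>
    using that by blast
  have "\<exists>E. E \<in> L \<and> M E \<le> inverse (real (Suc k)) \<and>
      uniform_limit (\<Gamma> - E) X Y sequentially" for k
  proof -
    have "inverse (real (Suc k)) > 0"
      by simp
    from uniform_limit_off_small_event[OF X Y lim this] show ?thesis
      by blast
  qed
  then obtain E where E: "\<And>k. E k \<in> L" "\<And>k. M (E k) \<le> inverse (real (Suc k))"
    "\<And>k. uniform_limit (\<Gamma> - E k) X Y sequentially"
    by metis
  have "(\<lambda>k. M (E k)) \<longlonglongrightarrow> 0"
    by (rule tendsto_sandwich[OF _ _ tendsto_const LIMSEQ_inverse_real_of_nat])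
      (simp_all add: E measure_nonneg del: of_nat_Suc)
  with E show "\<exists>E :: nat \<Rightarrow> 'a set. (\<forall>k. E k \<in> L) \<and> (\<lambda>k. M (E k)) \<longlonglongrightarrow> 0 \<and>
      (\<forall>k. uniform_limit (\<Gamma> - E k) X Y sequentially)"
    by blast
next
  assume "\<exists>E :: nat \<Rightarrow> 'a set. (\<forall>k. E k \<in> L) \<and> (\<lambda>k. M (E k)) \<longlonglongrightarrow> 0 \<and>
      (\<forall>k. uniform_limit (\<Gamma> - E k) X Y sequentially)"
  then obtain E :: "nat \<Rightarrow> 'a set" where "\<And>k. E k \<in> L" "(\<lambda>k. M (E k)) \<longlonglongrightarrow> 0"
    "\<And>k. uniform_limit (\<Gamma> - E k) X Y sequentially"
    by blast
  from tail_deviation_tendsto_zero[OF X Y this]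
  show "\<forall>\<epsilon>>0. (\<lambda>m. M (tail_deviation \<Gamma> X Y \<epsilon> m)) \<longlonglongrightarrow> 0"
    by simp
qed

end

lemma uncertain_variable_riesz_mean:
  assumes "\<And>n. n \<ge> 1 \<Longrightarrow> uncertain_variable \<Gamma> L (\<xi>s n)"
  shows "uncertain_variable \<Gamma> L (riesz_mean p \<xi>s n)"
  using assms unfolding uncertain_variable_def riesz_mean_def[abs_def]
  by (intro borel_measurable_sum borel_measurable_times) auto

theorem theorem4p5:
  fixes \<Gamma> :: "'a set" and L :: "'a set set" and M :: "'a set \<Rightarrow> real"
    and p :: "nat \<Rightarrow> real" and \<xi>s :: "nat \<Rightarrow> 'a \<Rightarrow> real" and \<xi> :: "'a \<Rightarrow> real"
  assumes "uncertainty_space \<Gamma> L M"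
    and "\<And>k. k \<ge> 1 \<Longrightarrow> p k > 0"
    and "\<And>n. n \<ge> 1 \<Longrightarrow> uncertain_variable \<Gamma> L (\<xi>s n)"
    and "uncertain_variable \<Gamma> L \<xi>"
  shows "\<xi>s \<in> u_R \<Gamma> L M p \<xi> \<longleftrightarrow> \<xi>s \<in> u_R_tilde \<Gamma> L M p \<xi>"
  using uncertainty_space.egorov_iff[OF assms(1)
      uncertain_variable_riesz_mean[of \<Gamma> L \<xi>s p, OF assms(3)] assms(4)]
  unfolding u_R_def u_R_tilde_def tail_deviation_def by simp

end
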